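(* Let $P\colon\mathcal{E}\to\mathcal{B}$ be a functor between small categories. Let $\mathcal{E}\xrightarrow{P_1}E_P\xrightarrow{P_2}\mathcal{B}$ be its directed opfibrational factorization and let $\mathcal{E}\xrightarrow{i_P}\int^{\mathcal{B}}K_P\xrightarrow{q_P}\mathcal{B}$ be its comprehensive factorization. Then $$\mathrm{csecat}(P)=\mathrm{dsecat}(q_P)\leq\mathrm{dsecat}(P)=\mathrm{dsecat}(P_2).$$
   Context: All categories are small. Directed opfibrational factorization: $E_P=P\downarrow1_{\mathcal{B}}$ is the comma category whose objects are pairs $(e,h\colon P(e)\to b)$, and whose morphisms $(e,h\colon P(e)\to b)\to(e',h'\colon P(e')\to b')$ are pairs $(g\colon e\to e',\,u\colon b\to b')$ with $u h=h'P(g)$. $P_1(e)=(e,1_{P(e)})$, $P_1(g)=(g,P(g))$, $P_2(e,h\colon P(e)\to b)=b$, $P_2(g,u)=u$; thus $P=P_2P_1$. Comprehensive factorization: $K_P\colon\mathcal{B}\to\mathbf{Set}$ is given by $K_P(b)=\pi_0(P\downarrow b)$, the set of connected components (with respect to unoriented zigzags) of the comma category $P\downarrow b$, whose objects are pairs $(e,\alpha\colon P(e)\to b)$; a morphism $u\colon b\to b'$ acts by $K_P(u)[e,\alpha]=[e,u\alpha]$. The category of elements $\int^{\mathcal{B}}K_P$ has objects $(b,\xi)$ with $\xi\in K_P(b)$; a morphism $(b,\xi)\to(b',\xi')$ is a morphism $f\colon b\to b'$ with $K_P(f)(\xi)=\xi'$. $q_P$ is the projection $(b,\xi)\mapsto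 b$, and $i_P(e)=(P(e),[(e,1_{P(e)})])$, $i_P(g)=P(g)$; thus $P=q_Pi_P$. The component sectional category of $P$ is by definition $\mathrm{csecat}(P):=\mathrm{dsecat}(q_P)$. A cover of a category $\mathcal{B}$ is a family of (not necessarily full) subcategories such that every morphism of $\mathcal{B}$ belongs to at least one of them. For a functor $Q\colon\mathcal{E}\to\mathcal{B}$, the directed sectional category $\mathrm{dsecat}(Q)$ is the least integer $n\geq0$ for which $\mathcal{B}$ admits a cover $\{\mathcal{U}_0,\dots,\mathcal{U}_n\}$ and, for every $i$, a functor $s_i\colon\mathcal{U}_i\to\mathcal{E}$ together with a natural transformation $Q s_i\Rightarrow\iota_i$, where $\iota_i\colon\mathcal{U}_i\hookrightarrow\mathcal{B}$ is the inclusion; it is $\infty$ if no such finite cover exists. *)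

theory Defs
  imports Main "HOL-Library.Extended_Nat"
begin

section \<open>Small categories, functors, natural transformations\<close>

text \<open>
  A small category has a set of objects and a set of arrows; the operations carry no information
  outside these sets. \<open>g \<cdot> f\<close> is the composite of \<open>f\<close> followed by \<open>g\<close>.
\<close>

record ('o, 'a) cat =
  Obj :: "'o set"
  Arr :: "'a set"
  Dom :: "'a \<Rightarrow> 'o"
  Cod :: "'a \<Rightarrow> 'o"
  Ident :: "'o \<Rightarrow> 'a"
  Comp :: "'a \<Rightarrow> 'a \<Rightarrow> 'a"  (infixl "\<cdot>\<index>" 70)

locale category =
  fixes C :: "('o, 'a) cat" (structure)
  assumes Dom_in [simp]: "f \<in> Arr C \<Longrightarrow> Dom C f \<in> Obj C"
    and Cod_in [simp]: "f \<in> Arr C \<Longrightarrow> Cod C f \<in> Obj C"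
    and Ident_in [simp]: "x \<in> Obj C \<Longrightarrow> Ident C x \<in> Arr C"
    and Dom_Ident [simp]: "x \<in> Obj C \<Longrightarrow> Dom C (Ident C x) = x"
    and Cod_Ident [simp]: "x \<in> Obj C \<Longrightarrow> Cod C (Ident C x) = x"
    and Comp_in [simp]: "\<lbrakk>f \<in> Arr C; g \<in> Arr C; Dom C g = Cod C f\<rbrakk> \<Longrightarrow> g \<cdot> f \<in> Arr C"
    and Dom_Comp [simp]: "\<lbrakk>f \<in> Arr C; g \<in> Arr C; Dom C g = Cod C f\<rbrakk> \<Longrightarrow> Dom C (g \<cdot> f) = Dom C f"
    and Cod_Comp [simp]: "\<lbrakk>f \<in> Arr C; g \<in> Arr C; Dom C g = Cod C f\<rbrakk> \<Longrightarrow> Cod C (g \<cdot> f) = Cod C g"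
    and Comp_Ident_right [simp]: "f \<in> Arr C \<Longrightarrow> f \<cdot> Ident C (Dom C f) = f"
    and Comp_Ident_left [simp]: "f \<in> Arr C \<Longrightarrow> Ident C (Cod C f) \<cdot> f = f"
    and Comp_assoc: "\<lbrakk>f \<in> Arr C; g \<in> Arr C; h \<in> Arr C; Dom C g = Cod C f; Dom C h = Cod C g\<rbrakk>
      \<Longrightarrow> (h \<cdot> g) \<cdot> f = h \<cdot> (g \<cdot> f)"

lemma (in category) Comp_Ident:
  "\<lbrakk>f \<in> Arr C; Dom C f = x\<rbrakk> \<Longrightarrow> f \<cdot> Ident C x = f"
  "\<lbrakk>f \<in> Arr C; Cod C f = y\<rbrakk> \<Longrightarrow> Ident C y \<cdot> f = f"
  by auto

record ('o, 'a, 'p, 'b) catfun =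
  OMap :: "'o \<Rightarrow> 'p"
  AMap :: "'a \<Rightarrow> 'b"

locale cat_functor = C: category C + D: category D
  for C :: "('o, 'a) cat" and D :: "('p, 'b) cat" and F :: "('o, 'a, 'p, 'b) catfun" +
  assumes OMap_in [simp]: "x \<in> Obj C \<Longrightarrow> OMap F x \<in> Obj D"
    and AMap_in [simp]: "f \<in> Arr C \<Longrightarrow> AMap F f \<in> Arr D"
    and Dom_AMap [simp]: "f \<in> Arr C \<Longrightarrow> Dom D (AMap F f) = OMap F (Dom C f)"
    and Cod_AMap [simp]: "f \<in> Arr C \<Longrightarrow> Cod D (AMap F f) = OMap F (Cod C f)"
    and AMap_Ident [simp]: "x \<in> Obj C \<Longrightarrow> AMap F (Ident C x) = Ident D (OMap F x)"
    and AMap_Comp [simp]: "\<lbrakk>f \<in> Arr C; g \<in> Arr C; Dom C g = Cod C f\<rbrakk>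
      \<Longrightarrow> AMap F (g \<cdot>\<^bsub>C\<^esub> f) = AMap F g \<cdot>\<^bsub>D\<^esub> AMap F f"

definition functor_comp :: "('p, 'b, 'q, 'c) catfun \<Rightarrow> ('o, 'a, 'p, 'b) catfun \<Rightarrow> ('o, 'a, 'q, 'c) catfun"
  where "functor_comp G F = \<lparr>OMap = OMap G \<circ> OMap F, AMap = AMap G \<circ> AMap F\<rparr>"

definition incl :: "('o, 'a, 'o, 'a) catfun"
  where "incl = \<lparr>OMap = id, AMap = id\<rparr>"

definition nat_trans :: "('o, 'a) cat \<Rightarrow> ('p, 'b) cat \<Rightarrow> ('o, 'a, 'p, 'b) catfun
    \<Rightarrow> ('o, 'a, 'p, 'b) catfun \<Rightarrow> ('o \<Rightarrow> 'b) \<Rightarrow> bool"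
  where "nat_trans C D F G \<tau> \<longleftrightarrow>
    cat_functor C D F \<and> cat_functor C D G \<and>
    (\<forall>x\<in>Obj C. \<tau> x \<in> Arr D \<and> Dom D (\<tau> x) = OMap F x \<and> Cod D (\<tau> x) = OMap G x) \<and>
    (\<forall>f\<in>Arr C. \<tau> (Cod C f) \<cdot>\<^bsub>D\<^esub> AMap F f = AMap G f \<cdot>\<^bsub>D\<^esub> \<tau> (Dom C f))"

section \<open>Directed sectional category\<close>

definition subcategory :: "('o, 'a) cat \<Rightarrow> ('o, 'a) cat \<Rightarrow> bool"
  where "subcategory U C \<longleftrightarrow>
    category U \<and> category C \<and> Obj U \<subseteq> Obj C \<and> Arr U \<subseteq> Arr C \<and>
    (\<forall>f\<in>Arr U. Dom U f = Dom C f \<and> Cod U f = Cod C f) \<and>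
    (\<forall>x\<in>Obj U. Ident U x = Ident C x) \<and>
    (\<forall>f\<in>Arr U. \<forall>g\<in>Arr U. Dom U g = Cod U f \<longrightarrow> g \<cdot>\<^bsub>U\<^esub> f = g \<cdot>\<^bsub>C\<^esub> f)"

definition cat_cover :: "('o, 'a) cat \<Rightarrow> 'i set \<Rightarrow> ('i \<Rightarrow> ('o, 'a) cat) \<Rightarrow> bool"
  where "cat_cover C I U \<longleftrightarrow>
    (\<forall>i\<in>I. subcategory (U i) C) \<and> (\<forall>f\<in>Arr C. \<exists>i\<in>I. f \<in> Arr (U i))"

text \<open>In \<^typ>\<open>enat\<close> the infimum of a nonempty set is its least element, and that of the empty set
  is \<open>\<infinity>\<close>.\<close>

definition dsecat :: "('o, 'a) cat \<Rightarrow> ('p, 'b) cat \<Rightarrow> ('o, 'a, 'p, 'b) catfun \<Rightarrow> enat"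
  where "dsecat E B Q = Inf {enat n | n. \<exists>U. cat_cover B {..n} U \<and>
    (\<forall>i\<le>n. \<exists>s \<tau>. cat_functor (U i) E s \<and> nat_trans (U i) B (functor_comp Q s) incl \<tau>)}"

section \<open>The directed opfibrational factorization\<close>

text \<open>
  Arrows of the categories built below record their source and target: \<open>(x, (g, u), y)\<close> stands
  for \<open>(g, u) : x \<rightarrow> y\<close>, because the same pair \<open>(g, u)\<close> can underlie arrows between different
  objects. Likewise for \<open>slice\<close> and \<open>elements\<close>.
\<close>

definition comma :: "('eo, 'ea) cat \<Rightarrow> ('bo, 'ba) cat \<Rightarrow> ('eo, 'ea, 'bo, 'ba) catfun
    \<Rightarrow> ('eo \<times> 'ba, ('eo \<times> 'ba) \<times> ('ea \<times> 'ba) \<times> ('eo \<times> 'ba)) cat"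
  where "comma E B P = (let Ob = {(e, h). e \<in> Obj E \<and> h \<in> Arr B \<and> Dom B h = OMap P e} in
    \<lparr>Obj = Ob,
     Arr = {((e, h), (g, u), (e', h')). (e, h) \<in> Ob \<and> (e', h') \<in> Ob \<and>
              g \<in> Arr E \<and> Dom E g = e \<and> Cod E g = e' \<and>
              u \<in> Arr B \<and> Dom B u = Cod B h \<and> Cod B u = Cod B h' \<and>
              u \<cdot>\<^bsub>B\<^esub> h = h' \<cdot>\<^bsub>B\<^esub> AMap P g},
     Dom = (\<lambda>(x, k, y). x),
     Cod = (\<lambda>(x, k, y). y),
     Ident = (\<lambda>(e, h). ((e, h), (Ident E e, Ident B (Cod B h)), (e, h))),
     Comp = (\<lambda>(y', (g', u'), z) (x, (g, u), y). (x, (g' \<cdot>\<^bsub>E\<^esub> g, u' \<cdot>\<^bsub>B\<^esub> u), z))\<rparr>)"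

definition comma_in :: "('eo, 'ea) cat \<Rightarrow> ('bo, 'ba) cat \<Rightarrow> ('eo, 'ea, 'bo, 'ba) catfun
    \<Rightarrow> ('eo, 'ea, 'eo \<times> 'ba, ('eo \<times> 'ba) \<times> ('ea \<times> 'ba) \<times> ('eo \<times> 'ba)) catfun"
  where "comma_in E B P = (let o1 = (\<lambda>e. (e, Ident B (OMap P e))) in
    \<lparr>OMap = o1, AMap = (\<lambda>g. (o1 (Dom E g), (g, AMap P g), o1 (Cod E g)))\<rparr>)"

definition comma_proj :: "('bo, 'ba) cat
    \<Rightarrow> ('eo \<times> 'ba, ('eo \<times> 'ba) \<times> ('ea \<times> 'ba) \<times> ('eo \<times> 'ba), 'bo, 'ba) catfun"
  where "comma_proj B = \<lparr>OMap = (\<lambda>(e, h). Cod B h), AMap = (\<lambda>(x, (g, u), y). u)\<rparr>"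

section \<open>The comprehensive factorization\<close>

definition slice :: "('eo, 'ea) cat \<Rightarrow> ('bo, 'ba) cat \<Rightarrow> ('eo, 'ea, 'bo, 'ba) catfun \<Rightarrow> 'bo
    \<Rightarrow> ('eo \<times> 'ba, ('eo \<times> 'ba) \<times> 'ea \<times> ('eo \<times> 'ba)) cat"
  where "slice E B P b =
    (let Ob = {(e, \<alpha>). e \<in> Obj E \<and> \<alpha> \<in> Arr B \<and> Dom B \<alpha> = OMap P e \<and> Cod B \<alpha> = b} in
    \<lparr>Obj = Ob,
     Arr = {((e, \<alpha>), g, (e', \<alpha>')). (e, \<alpha>) \<in> Ob \<and> (e', \<alpha>') \<in> Ob \<and>
              g \<in> Arr E \<and> Dom E g = e \<and> Cod E g = e' \<and> \<alpha> = \<alpha>' \<cdot>\<^bsub>B\<^esub> AMap P g},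
     Dom = (\<lambda>(x, k, y). x),
     Cod = (\<lambda>(x, k, y). y),
     Ident = (\<lambda>(e, \<alpha>). ((e, \<alpha>), Ident E e, (e, \<alpha>))),
     Comp = (\<lambda>(y', g', z) (x, g, y). (x, g' \<cdot>\<^bsub>E\<^esub> g, z))\<rparr>)"

definition zigzag :: "('o, 'a) cat \<Rightarrow> ('o \<times> 'o) set"
  where "zigzag C = {(x, y). x \<in> Obj C \<and> y \<in> Obj C \<and>
    (x, y) \<in> ({(Dom C f, Cod C f) | f. f \<in> Arr C} \<union> {(Cod C f, Dom C f) | f. f \<in> Arr C})\<^sup>*}"

definition pi0 :: "('o, 'a) cat \<Rightarrow> 'o set set"
  where "pi0 C = Obj C // zigzag C"

definition component :: "('o, 'a) cat \<Rightarrow> 'o \<Rightarrow> 'o set"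
  where "component C x = zigzag C `` {x}"

record ('o, 'a, 'x) setfun =
  SOb :: "'o \<Rightarrow> 'x set"
  SMap :: "'a \<Rightarrow> 'x \<Rightarrow> 'x"

locale set_functor = category C
  for C :: "('o, 'a) cat" and K :: "('o, 'a, 'x) setfun" +
  assumes SMap_in: "\<lbrakk>f \<in> Arr C; \<xi> \<in> SOb K (Dom C f)\<rbrakk> \<Longrightarrow> SMap K f \<xi> \<in> SOb K (Cod C f)"
    and SMap_Ident: "\<lbrakk>x \<in> Obj C; \<xi> \<in> SOb K x\<rbrakk> \<Longrightarrow> SMap K (Ident C x) \<xi> = \<xi>"
    and SMap_Comp: "\<lbrakk>f \<in> Arr C; g \<in> Arr C; Dom C g = Cod C f; \<xi> \<in> SOb K (Dom C f)\<rbrakk>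
      \<Longrightarrow> SMap K (g \<cdot>\<^bsub>C\<^esub> f) \<xi> = SMap K g (SMap K f \<xi>)"

definition elements :: "('o, 'a) cat \<Rightarrow> ('o, 'a, 'x) setfun
    \<Rightarrow> ('o \<times> 'x, ('o \<times> 'x) \<times> 'a \<times> ('o \<times> 'x)) cat"
  where "elements B K = (let Ob = {(b, \<xi>). b \<in> Obj B \<and> \<xi> \<in> SOb K b} in
    \<lparr>Obj = Ob,
     Arr = {((b, \<xi>), f, (b', \<xi>')). (b, \<xi>) \<in> Ob \<and> (b', \<xi>') \<in> Ob \<and>
              f \<in> Arr B \<and> Dom B f = b \<and> Cod B f = b' \<and> SMap K f \<xi> = \<xi>'},
     Dom = (\<lambda>(x, k, y). x),
     Cod = (\<lambda>(x, k, y). y),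
     Ident = (\<lambda>(b, \<xi>). ((b, \<xi>), Ident B b, (b, \<xi>))),
     Comp = (\<lambda>(y', f', z) (x, f, y). (x, f' \<cdot>\<^bsub>B\<^esub> f, z))\<rparr>)"

definition elements_proj :: "('o \<times> 'x, ('o \<times> 'x) \<times> 'a \<times> ('o \<times> 'x), 'o, 'a) catfun"
  where "elements_proj = \<lparr>OMap = fst, AMap = (\<lambda>(x, f, y). f)\<rparr>"

text \<open>The action of \<open>u\<close> is \<open>[e, \<alpha>] \<mapsto> [e, u \<alpha>]\<close>. It is written as a union over all
  representatives; by \<open>KP_map_component\<close> below, every representative contributes the same class.\<close>

definition KP :: "('eo, 'ea) cat \<Rightarrow> ('bo, 'ba) cat \<Rightarrow> ('eo, 'ea, 'bo, 'ba) catfun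
    \<Rightarrow> ('bo, 'ba, ('eo \<times> 'ba) set) setfun"
  where "KP E B P =
    \<lparr>SOb = (\<lambda>b. pi0 (slice E B P b)),
     SMap = (\<lambda>u \<xi>. \<Union>(e, \<alpha>)\<in>\<xi>. component (slice E B P (Cod B u)) (e, u \<cdot>\<^bsub>B\<^esub> \<alpha>))\<rparr>"

definition compr_in :: "('eo, 'ea) cat \<Rightarrow> ('bo, 'ba) cat \<Rightarrow> ('eo, 'ea, 'bo, 'ba) catfun
    \<Rightarrow> ('eo, 'ea, 'bo \<times> ('eo \<times> 'ba) set,
        ('bo \<times> ('eo \<times> 'ba) set) \<times> 'ba \<times> ('bo \<times> ('eo \<times> 'ba) set)) catfun"
  where "compr_in E B P =
    (let o1 = (\<lambda>e. (OMap P e, component (slice E B P (OMap P e)) (e, Ident B (OMap P e)))) in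
    \<lparr>OMap = o1, AMap = (\<lambda>g. (o1 (Dom E g), AMap P g, o1 (Cod E g)))\<rparr>)"

definition csecat :: "('eo, 'ea) cat \<Rightarrow> ('bo, 'ba) cat \<Rightarrow> ('eo, 'ea, 'bo, 'ba) catfun \<Rightarrow> enat"
  where "csecat E B P = dsecat (elements B (KP E B P)) B elements_proj"

section \<open>Both constructions are factorizations of \<open>P\<close>\<close>

context cat_functor
begin

lemma category_comma: "category (comma C D F)"
proof unfold_locales
  fix k l assume "k \<in> Arr (comma C D F)" "l \<in> Arr (comma C D F)"
    and "Dom (comma C D F) l = Cod (comma C D F) k"
  moreover obtain e h g u e' h' e1 h1 g' u' e'' h'' where
    "k = ((e, h), (g, u), (e', h'))" "l = ((e1, h1), (g', u'), (e'', h''))"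
    by (metis surj_pair)
  ultimately have
    kl: "k = ((e, h), (g, u), (e', h'))" "l = ((e', h'), (g', u'), (e'', h''))" and
    *: "h \<in> Arr D" "Dom D h = OMap F e" "h' \<in> Arr D" "Dom D h' = OMap F e'"
       "h'' \<in> Arr D" "Dom D h'' = OMap F e''" "e \<in> Obj C" "e' \<in> Obj C" "e'' \<in> Obj C"
       "g \<in> Arr C" "Dom C g = e" "Cod C g = e'" "g' \<in> Arr C" "Dom C g' = e'" "Cod C g' = e''"
       "u \<in> Arr D" "Dom D u = Cod D h" "Cod D u = Cod D h'"
       "u' \<in> Arr D" "Dom D u' = Cod D h'" "Cod D u' = Cod D h''" and
    sq: "u \<cdot>\<^bsub>D\<^esub> h = h' \<cdot>\<^bsub>D\<^esub> AMap F g" "u' \<cdot>\<^bsub>D\<^esub> h' = h'' \<cdot>\<^bsub>D\<^esub> AMap F g'"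
    by (simp_all add: comma_def Let_def)
  have "(u' \<cdot>\<^bsub>D\<^esub> u) \<cdot>\<^bsub>D\<^esub> h = (u' \<cdot>\<^bsub>D\<^esub> h') \<cdot>\<^bsub>D\<^esub> AMap F g"
    using * sq(1) by (simp add: D.Comp_assoc)
  also have "\<dots> = h'' \<cdot>\<^bsub>D\<^esub> AMap F (g' \<cdot>\<^bsub>C\<^esub> g)"
    using * sq(2) by (simp add: D.Comp_assoc)
  finally show "l \<cdot>\<^bsub>comma C D F\<^esub> k \<in> Arr (comma C D F)"
    using * kl by (simp add: comma_def Let_def)
qed (auto simp: comma_def Let_def C.Comp_assoc D.Comp_assoc C.Comp_Ident D.Comp_Ident)

lemma comma_in_functor: "cat_functor C (comma C D F) (comma_in C D F)"
proof -
  interpret M: category "comma C D F" by (rule category_comma)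
  have *: "AMap F g \<cdot>\<^bsub>D\<^esub> Ident D (OMap F (Dom C g)) = AMap F g"
    "Ident D (OMap F (Cod C g)) \<cdot>\<^bsub>D\<^esub> AMap F g = AMap F g" if "g \<in> Arr C" for g
    using that D.Comp_Ident_right[of "AMap F g"] D.Comp_Ident_left[of "AMap F g"] by auto
  show ?thesis
    by unfold_locales (auto simp: comma_def comma_in_def Let_def *)
qed

lemma comma_proj_functor: "cat_functor (comma C D F) D (comma_proj D)"
proof -
  interpret M: category "comma C D F" by (rule category_comma)
  show ?thesis
    by unfold_locales (auto simp: comma_def comma_proj_def Let_def)
qed

lemma comma_factorization:
  "x \<in> Obj C \<Longrightarrow> OMap (functor_comp (comma_proj D) (comma_in C D F)) x = OMap F x"
  "f \<in> Arr C \<Longrightarrow> AMap (functor_comp (comma_proj D) (comma_in C D F)) f = AMap F f"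
  by (simp_all add: functor_comp_def comma_in_def comma_proj_def Let_def)

lemma slice_simps:
  "(e, \<alpha>) \<in> Obj (slice C D F b) \<longleftrightarrow>
    e \<in> Obj C \<and> \<alpha> \<in> Arr D \<and> Dom D \<alpha> = OMap F e \<and> Cod D \<alpha> = b"
  "(x, g, y) \<in> Arr (slice C D F b) \<longleftrightarrow> x \<in> Obj (slice C D F b) \<and> y \<in> Obj (slice C D F b) \<and>
    g \<in> Arr C \<and> Dom C g = fst x \<and> Cod C g = fst y \<and> snd x = snd y \<cdot>\<^bsub>D\<^esub> AMap F g"
  "Dom (slice C D F b) (x, g, y) = x"
  "Cod (slice C D F b) (x, g, y) = y"
  "Ident (slice C D F b) x = (x, Ident C (fst x), x)"
  "(y', g', z) \<cdot>\<^bsub>slice C D F b\<^esub> (x, g, y) = (x, g' \<cdot>\<^bsub>C\<^esub> g, z)"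
  by (cases x; cases y; simp add: slice_def Let_def; fail)+

lemma category_slice: "category (slice C D F b)"
proof unfold_locales
  let ?S = "slice C D F b"
  fix k assume k: "k \<in> Arr ?S"
  obtain x g y where [simp]: "k = (x, g, y)" by (metis surj_pair)
  show "Dom ?S k \<in> Obj ?S" "Cod ?S k \<in> Obj ?S"
    using k by (simp_all add: slice_simps)
  show "k \<cdot>\<^bsub>?S\<^esub> Ident ?S (Dom ?S k) = k" "Ident ?S (Cod ?S k) \<cdot>\<^bsub>?S\<^esub> k = k"
    using k by (simp_all add: slice_simps C.Comp_Ident)
  fix l assume l: "l \<in> Arr ?S" and kl: "Dom ?S l = Cod ?S k"
  obtain g' z where [simp]: "l = (y, g', z)"
    using kl by (cases l) (simp add: slice_simps)
  have z: "snd z \<in> Arr D" "Dom D (snd z) = OMap F (fst z)"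
    using l by (cases z; simp add: slice_simps)+
  show "l \<cdot>\<^bsub>?S\<^esub> k \<in> Arr ?S"
    using k l z by (simp add: slice_simps D.Comp_assoc)
  show "Dom ?S (l \<cdot>\<^bsub>?S\<^esub> k) = Dom ?S k" "Cod ?S (l \<cdot>\<^bsub>?S\<^esub> k) = Cod ?S l"
    by (simp_all add: slice_simps)
  fix m assume m: "m \<in> Arr ?S" and lm: "Dom ?S m = Cod ?S l"
  obtain g'' w where [simp]: "m = (z, g'', w)"
    using lm by (cases m) (simp add: slice_simps)
  show "(m \<cdot>\<^bsub>?S\<^esub> l) \<cdot>\<^bsub>?S\<^esub> k = m \<cdot>\<^bsub>?S\<^esub> (l \<cdot>\<^bsub>?S\<^esub> k)"
    using k l m by (simp add: slice_simps C.Comp_assoc)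
next
  let ?S = "slice C D F b"
  fix x assume x: "x \<in> Obj ?S"
  then show "Ident ?S x \<in> Arr ?S"
    by (cases x) (simp add: slice_simps D.Comp_Ident)
  show "Dom ?S (Ident ?S x) = x" "Cod ?S (Ident ?S x) = x"
    by (simp_all add: slice_simps)
qed

end

lemma (in category) arr_zigzag: "f \<in> Arr C \<Longrightarrow> (Dom C f, Cod C f) \<in> zigzag C"
  by (auto simp: zigzag_def)

lemma equiv_zigzag: "equiv (Obj C) (zigzag C)"
proof (rule equivI)
  let ?S = "{(Dom C f, Cod C f) | f. f \<in> Arr C} \<union> {(Cod C f, Dom C f) | f. f \<in> Arr C}"
  have "sym (?S\<^sup>*)" by (intro sym_rtrancl symI) blast
  then show "sym (zigzag C)" unfolding zigzag_def by (auto intro!: symI dest: symD)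
  show "zigzag C \<subseteq> Obj C \<times> Obj C" by (auto simp: zigzag_def)
  show "refl_on (Obj C) (zigzag C)" by (auto simp: zigzag_def intro!: refl_onI)
  show "trans (zigzag C)" unfolding zigzag_def by (auto intro!: transI intro: rtrancl_trans)
qed

context cat_functor
begin

lemma zigzag_slice_map:
  assumes u: "u \<in> Arr D" and z: "((e, \<alpha>), (e', \<alpha>')) \<in> zigzag (slice C D F (Dom D u))"
  shows "((e, u \<cdot>\<^bsub>D\<^esub> \<alpha>), (e', u \<cdot>\<^bsub>D\<^esub> \<alpha>')) \<in> zigzag (slice C D F (Cod D u))"
proof -
  define S where "S b = {(Dom (slice C D F b) f, Cod (slice C D F b) f) | f. f \<in> Arr (slice C D F b)}
    \<union> {(Cod (slice C D F b) f, Dom (slice C D F b) f) | f. f \<in> Arr (slice C D F b)}" for b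
  define m where "m x = (fst x, u \<cdot>\<^bsub>D\<^esub> snd x)" for x :: "'o \<times> 'b"
  have ob: "m x \<in> Obj (slice C D F (Cod D u))" if "x \<in> Obj (slice C D F (Dom D u))" for x
    using that u by (auto simp: m_def slice_def Let_def)
  have ar: "(m (fst k), fst (snd k), m (snd (snd k))) \<in> Arr (slice C D F (Cod D u))"
    if "k \<in> Arr (slice C D F (Dom D u))" for k
    using that u by (auto simp: m_def slice_def Let_def D.Comp_assoc)
  have st: "(m x, m y) \<in> S (Cod D u)" if "(x, y) \<in> S (Dom D u)" for x y
  proof -
    from that obtain k where k: "k \<in> Arr (slice C D F (Dom D u))"
      "x = fst k \<and> y = snd (snd k) \<or> y = fst k \<and> x = snd (snd k)"
      by (force simp: S_def slice_def Let_def)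
    have *: "Dom (slice C D F (Cod D u)) (m (fst k), fst (snd k), m (snd (snd k))) = m (fst k)"
      "Cod (slice C D F (Cod D u)) (m (fst k), fst (snd k), m (snd (snd k))) = m (snd (snd k))"
      by (simp_all add: slice_def Let_def)
    have "(m (fst k), m (snd (snd k))) \<in> S (Cod D u)" "(m (snd (snd k)), m (fst k)) \<in> S (Cod D u)"
      using ar[OF k(1)] *[symmetric] unfolding S_def by blast+
    with k(2) show ?thesis by auto
  qed
  have "(m x, m y) \<in> (S (Cod D u))\<^sup>*" if "(x, y) \<in> (S (Dom D u))\<^sup>*" for x y
    using that by induction (auto intro: st rtrancl_into_rtrancl)
  then show ?thesis
    using z ob[of "(e, \<alpha>)"] ob[of "(e', \<alpha>')"] unfolding zigzag_def S_def[symmetric]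
    by (auto simp: m_def)
qed

lemma KP_map_component:
  assumes u: "u \<in> Arr D" and x: "(e, \<alpha>) \<in> Obj (slice C D F (Dom D u))"
  shows "SMap (KP C D F) u (component (slice C D F (Dom D u)) (e, \<alpha>))
    = component (slice C D F (Cod D u)) (e, u \<cdot>\<^bsub>D\<^esub> \<alpha>)"
proof -
  let ?S = "slice C D F (Dom D u)" and ?T = "slice C D F (Cod D u)"
  have eq: "component ?T (e', u \<cdot>\<^bsub>D\<^esub> \<alpha>') = component ?T (e, u \<cdot>\<^bsub>D\<^esub> \<alpha>)"
    if "(e', \<alpha>') \<in> component ?S (e, \<alpha>)" for e' \<alpha>'
  proof -
    have "((e, \<alpha>), (e', \<alpha>')) \<in> zigzag ?S"
      using that by (simp add: component_def)
    from equiv_class_eq[OF equiv_zigzag zigzag_slice_map[OF u this]] show ?thesis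
      by (simp add: component_def)
  qed
  have self: "(e, \<alpha>) \<in> component ?S (e, \<alpha>)"
    unfolding component_def using equiv_class_self[OF equiv_zigzag x] .
  have "(\<lambda>(e', \<alpha>'). component ?T (e', u \<cdot>\<^bsub>D\<^esub> \<alpha>')) ` component ?S (e, \<alpha>)
      = (\<lambda>_. component ?T (e, u \<cdot>\<^bsub>D\<^esub> \<alpha>)) ` component ?S (e, \<alpha>)"
    using eq by (intro image_cong refl) (simp only: split_paired_all prod.case)
  also have "\<dots> = {component ?T (e, u \<cdot>\<^bsub>D\<^esub> \<alpha>)}"
    using self by blast
  finally show ?thesis by (simp add: KP_def)
qed

lemma KP_set_functor: "set_functor D (KP C D F)"
proof unfold_locales
  have rep: "\<exists>e \<alpha>. (e, \<alpha>) \<in> Obj (slice C D F b) \<and> \<xi> = component (slice C D F b) (e, \<alpha>)"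
    if "\<xi> \<in> SOb (KP C D F) b" for b \<xi>
    using that unfolding KP_def pi0_def component_def by (auto elim!: quotientE)
  have ob: "(e, u \<cdot>\<^bsub>D\<^esub> \<alpha>) \<in> Obj (slice C D F (Cod D u))"
    if "u \<in> Arr D" "(e, \<alpha>) \<in> Obj (slice C D F (Dom D u))" for u e \<alpha>
    using that by (auto simp: slice_def Let_def)
  show "SMap (KP C D F) u \<xi> \<in> SOb (KP C D F) (Cod D u)"
    if "u \<in> Arr D" "\<xi> \<in> SOb (KP C D F) (Dom D u)" for u \<xi>
  proof -
    from rep[OF that(2)] obtain e \<alpha> where x: "(e, \<alpha>) \<in> Obj (slice C D F (Dom D u))"
      and \<xi>: "\<xi> = component (slice C D F (Dom D u)) (e, \<alpha>)" by blast
    show ?thesis using ob[OF that(1) x]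
      by (simp add: \<xi> KP_map_component[OF that(1) x])
        (simp add: KP_def pi0_def component_def quotientI)
  qed
  show "SMap (KP C D F) (Ident D b) \<xi> = \<xi>" if "b \<in> Obj D" "\<xi> \<in> SOb (KP C D F) b" for b \<xi>
  proof -
    from rep[OF that(2)] obtain e \<alpha> where x: "(e, \<alpha>) \<in> Obj (slice C D F b)"
      and \<xi>: "\<xi> = component (slice C D F b) (e, \<alpha>)" by blast
    have "\<alpha> \<in> Arr D" "Cod D \<alpha> = b" using x by (auto simp: slice_def Let_def)
    then show ?thesis
      using KP_map_component[of "Ident D b" e \<alpha>] x that(1) D.Comp_Ident_left[of \<alpha>] by (simp add: \<xi>)
  qed
  show "SMap (KP C D F) (v \<cdot>\<^bsub>D\<^esub> u) \<xi> = SMap (KP C D F) v (SMap (KP C D F) u \<xi>)"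
    if uv: "u \<in> Arr D" "v \<in> Arr D" "Dom D v = Cod D u" and "\<xi> \<in> SOb (KP C D F) (Dom D u)" for u v \<xi>
  proof -
    from rep[OF that(4)] obtain e \<alpha> where x: "(e, \<alpha>) \<in> Obj (slice C D F (Dom D u))"
      and \<xi>: "\<xi> = component (slice C D F (Dom D u)) (e, \<alpha>)" by blast
    have "\<alpha> \<in> Arr D" "Cod D \<alpha> = Dom D u" using x by (auto simp: slice_def Let_def)
    then show ?thesis
      using KP_map_component[of "v \<cdot>\<^bsub>D\<^esub> u" e \<alpha>] KP_map_component[of u e \<alpha>]
        KP_map_component[of v e "u \<cdot>\<^bsub>D\<^esub> \<alpha>"] ob[OF uv(1) x] x uv by (simp add: \<xi> D.Comp_assoc)
  qed
qed

end

lemma (in set_functor) category_elements: "category (elements C K)"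
  by unfold_locales (auto simp: elements_def Let_def Comp_assoc SMap_in SMap_Ident SMap_Comp)

lemma (in set_functor) elements_proj_functor: "cat_functor (elements C K) C elements_proj"
proof -
  interpret M: category "elements C K" by (rule category_elements)
  show ?thesis
    by unfold_locales (auto simp: elements_def elements_proj_def Let_def)
qed

context cat_functor
begin

lemma compr_in_functor: "cat_functor C (elements D (KP C D F)) (compr_in C D F)"
proof -
  interpret K: set_functor D "KP C D F" by (rule KP_set_functor)
  interpret M: category "elements D (KP C D F)" by (rule K.category_elements)
  have ob: "(e, Ident D (OMap F e)) \<in> Obj (slice C D F (OMap F e))" if "e \<in> Obj C" for e
    using that by (simp add: slice_def Let_def)
  have cl: "component (slice C D F (OMap F e)) (e, Ident D (OMap F e)) \<in> SOb (KP C D F) (OMap F e)"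
    if "e \<in> Obj C" for e
    using ob[OF that] by (simp add: KP_def pi0_def component_def quotientI)
  have mv: "SMap (KP C D F) (AMap F g)
      (component (slice C D F (OMap F (Dom C g))) (Dom C g, Ident D (OMap F (Dom C g))))
    = component (slice C D F (OMap F (Cod C g))) (Cod C g, Ident D (OMap F (Cod C g)))"
    if g: "g \<in> Arr C" for g
  proof -
    let ?S = "slice C D F (OMap F (Cod C g))"
    let ?x = "(Dom C g, AMap F g)" and ?y = "(Cod C g, Ident D (OMap F (Cod C g)))"
    have k: "(?x, g, ?y) \<in> Arr ?S"
      using g D.Comp_Ident_left[of "AMap F g"] by (simp add: slice_def Let_def)
    have "(?x, ?y) \<in> zigzag ?S"
      using category.arr_zigzag[OF category_slice k] by (simp add: slice_def Let_def)
    then have "component ?S ?x = component ?S ?y"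
      unfolding component_def by (rule equiv_class_eq[OF equiv_zigzag])
    then show ?thesis
      using KP_map_component[of "AMap F g" "Dom C g" "Ident D (OMap F (Dom C g))"] g ob[of "Dom C g"]
        D.Comp_Ident_right[of "AMap F g"] by simp
  qed
  show ?thesis
    by unfold_locales (auto simp: elements_def compr_in_def Let_def cl mv)
qed

lemma compr_factorization:
  "x \<in> Obj C \<Longrightarrow> OMap (functor_comp elements_proj (compr_in C D F)) x = OMap F x"
  "f \<in> Arr C \<Longrightarrow> AMap (functor_comp elements_proj (compr_in C D F)) f = AMap F f"
  by (simp_all add: functor_comp_def compr_in_def elements_proj_def Let_def)

end

end

theory Submission
  imports Defs
begin

text \<open>
  A section over \<open>U\<close> up to a natural transformation can be pushed along any functor
  \<open>G : E \<rightarrow> E'\<close> equipped with a natural transformation \<open>Q' G \<Rightarrow> Q\<close>, so such a lax triangle gives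
  \<open>dsecat Q' \<le> dsecat Q\<close>. The strict triangles \<open>q\<^sub>P i\<^sub>P = P\<close> and \<open>P\<^sub>2 P\<^sub>1 = P\<close> give two of the three
  inequalities; the third comes from the projection \<open>(e, h) \<mapsto> e\<close> of the comma category, for which
  the structure maps \<open>h\<close> themselves form a natural transformation to \<open>P\<^sub>2\<close>.
\<close>

lemma cat_functor_comp:
  assumes "cat_functor C D F" and "cat_functor D A G"
  shows "cat_functor C A (functor_comp G F)"
proof -
  interpret F: cat_functor C D F by (fact assms)
  interpret G: cat_functor D A G by (fact assms)
  show ?thesis
    by unfold_locales (auto simp: functor_comp_def)
qed

lemma nat_trans_whisker:
  assumes "cat_functor C D H" and "nat_trans D A F G \<tau>"
  shows "nat_trans C A (functor_comp F H) (functor_comp G H) (\<lambda>x. \<tau> (OMap H x))"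
proof -
  interpret H: cat_functor C D H by (fact assms)
  show ?thesis
    using assms cat_functor_comp[OF assms(1)]
    \<comment> \<open>Reading \<open>OMap H (Cod C f)\<close> as \<open>Cod D (AMap H f)\<close>
      turns the square at \<open>f\<close> into naturality of \<tau> at
      \<open>AMap H f\<close>.\<close>
    by (auto simp: nat_trans_def functor_comp_def simp flip: H.Cod_AMap H.Dom_AMap)
qed

lemma nat_trans_vcomp:
  assumes \<sigma>: "nat_trans C D F G \<sigma>" and \<tau>: "nat_trans C D G H \<tau>"
  shows "nat_trans C D F H (\<lambda>x. \<tau> x \<cdot>\<^bsub>D\<^esub> \<sigma> x)"
proof -
  interpret F: cat_functor C D F using \<sigma> by (simp add: nat_trans_def)
  interpret G: cat_functor C D G using \<sigma> by (simp add: nat_trans_def)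
  interpret H: cat_functor C D H using \<tau> by (simp add: nat_trans_def)
  note [simp] = \<sigma>[unfolded nat_trans_def] \<tau>[unfolded nat_trans_def]
  have "(\<tau> (Cod C f) \<cdot>\<^bsub>D\<^esub> \<sigma> (Cod C f)) \<cdot>\<^bsub>D\<^esub> AMap F f
      = AMap H f \<cdot>\<^bsub>D\<^esub> (\<tau> (Dom C f) \<cdot>\<^bsub>D\<^esub> \<sigma> (Dom C f))" if f: "f \<in> Arr C" for f
  proof -
    have "(\<tau> (Cod C f) \<cdot>\<^bsub>D\<^esub> \<sigma> (Cod C f)) \<cdot>\<^bsub>D\<^esub> AMap F f
        = \<tau> (Cod C f) \<cdot>\<^bsub>D\<^esub> (AMap G f \<cdot>\<^bsub>D\<^esub> \<sigma> (Dom C f))"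
      using f by (simp add: F.D.Comp_assoc)
    also have "\<dots> = (\<tau> (Cod C f) \<cdot>\<^bsub>D\<^esub> AMap G f) \<cdot>\<^bsub>D\<^esub> \<sigma> (Dom C f)"
      using f by (subst F.D.Comp_assoc) simp_all
    also have "\<dots> = AMap H f \<cdot>\<^bsub>D\<^esub> (\<tau> (Dom C f) \<cdot>\<^bsub>D\<^esub> \<sigma> (Dom C f))"
      using f by (simp add: F.D.Comp_assoc)
    finally show ?thesis .
  qed
  then show ?thesis
    by (simp add: nat_trans_def F.cat_functor_axioms H.cat_functor_axioms)
qed

text \<open>Functor records are unconstrained outside the category, so the factorizations give only
  agreement on objects and arrows, not equal records; this is the form in which they enter
  \<open>dsecat_le_lax\<close>.\<close>

lemma nat_trans_Ident:
  assumes F: "cat_functor C D F" and G: "cat_functor C D G"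
    and ob: "\<And>x. x \<in> Obj C \<Longrightarrow> OMap F x = OMap G x"
    and ar: "\<And>f. f \<in> Arr C \<Longrightarrow> AMap F f = AMap G f"
  shows "nat_trans C D F G (\<lambda>x. Ident D (OMap G x))"
proof -
  interpret G: cat_functor C D G by (fact G)
  show ?thesis
    using F G by (simp add: nat_trans_def ob ar G.D.Comp_Ident)
qed

lemma dsecat_le_lax:
  assumes G: "cat_functor E E' G" and \<sigma>: "nat_trans E B (functor_comp Q' G) Q \<sigma>"
  shows "dsecat E' B Q' \<le> dsecat E B Q"
proof -
  have "\<exists>s' \<tau>'. cat_functor U E' s' \<and> nat_trans U B (functor_comp Q' s') incl \<tau>'"
    if s: "cat_functor U E s" and \<tau>: "nat_trans U B (functor_comp Q s) incl \<tau>" for U s \<tau>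
  proof -
    have "nat_trans U B (functor_comp Q' (functor_comp G s)) (functor_comp Q s) (\<lambda>x. \<sigma> (OMap s x))"
      using nat_trans_whisker[OF s \<sigma>] by (simp add: functor_comp_def comp_assoc)
    from nat_trans_vcomp[OF this \<tau>] cat_functor_comp[OF s G] show ?thesis by blast
  qed
  then show ?thesis
    \<comment> \<open>The cover is kept, so every \<open>n\<close> admissible for \<open>Q\<close>
      is admissible for \<open>Q'\<close>, and the larger set has the smaller infimum.\<close>
    unfolding dsecat_def by (intro Inf_superset_mono) blast
qed

text \<open>This is right adjoint to \<open>comma_in\<close>: an arrow from
  \<open>(e, Ident B (OMap P e))\<close> to \<open>(e', h')\<close> is determined by its part
  \<open>g\<close> from \<open>e\<close> to \<open>e'\<close>.\<close>

definition comma_dom :: "('eo \<times> 'ba, ('eo \<times> 'ba) \<times> ('ea \<times> 'ba) \<times> ('eo \<times> 'ba), 'eo, 'ea) catfun"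
  where "comma_dom = \<lparr>OMap = fst, AMap = (\<lambda>(x, (g, u), y). g)\<rparr>"

context cat_functor
begin

lemma comma_dom_functor: "cat_functor (comma C D F) C comma_dom"
proof -
  interpret M: category "comma C D F" by (rule category_comma)
  show ?thesis
    by unfold_locales (auto simp: comma_def comma_dom_def Let_def)
qed

text \<open>Naturality at \<open>(g, u)\<close> is the very equation \<open>u h = h' P(g)\<close>
  required of arrows of the comma category.\<close>

lemma nat_trans_comma_dom:
  "nat_trans (comma C D F) D (functor_comp F comma_dom) (comma_proj D) snd"
  using cat_functor_comp[OF comma_dom_functor cat_functor_axioms] comma_proj_functor
  by (auto simp: nat_trans_def functor_comp_def comma_def comma_dom_def comma_proj_def Let_def)

lemma dsecat_comma_proj: "dsecat (comma C D F) D (comma_proj D) = dsecat C D F"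
proof (rule antisym)
  show "dsecat (comma C D F) D (comma_proj D) \<le> dsecat C D F"
    by (rule dsecat_le_lax[OF comma_in_functor nat_trans_Ident[OF
          cat_functor_comp[OF comma_in_functor comma_proj_functor] cat_functor_axioms
          comma_factorization]])
  show "dsecat C D F \<le> dsecat (comma C D F) D (comma_proj D)"
    by (rule dsecat_le_lax[OF comma_dom_functor nat_trans_comma_dom])
qed

lemma dsecat_elements_le: "dsecat (elements D (KP C D F)) D elements_proj \<le> dsecat C D F"
proof -
  interpret K: set_functor D "KP C D F" by (rule KP_set_functor)
  show ?thesis
    by (rule dsecat_le_lax[OF compr_in_functor nat_trans_Ident[OF
          cat_functor_comp[OF compr_in_functor K.elements_proj_functor] cat_functor_axioms
          compr_factorization]])
qed

end

theorem theorem6p13: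
  fixes E :: "('eo, 'ea) cat" and B :: "('bo, 'ba) cat" and P :: "('eo, 'ea, 'bo, 'ba) catfun"
  assumes "category E" and "category B" and "cat_functor E B P"
  shows "csecat E B P = dsecat (elements B (KP E B P)) B elements_proj \<and>
    dsecat (elements B (KP E B P)) B elements_proj \<le> dsecat E B P \<and>
    dsecat E B P = dsecat (comma E B P) B (comma_proj B)"
  using cat_functor.dsecat_elements_le[OF assms(3)] cat_functor.dsecat_comma_proj[OF assms(3)]
  by (simp add: csecat_def)

end
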